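(* Let $(V,\delta_V)$ be an abelian InvDer Lie algebra and $(L,[-,-]_L,\delta)$ an InvDer Lie algebra over $\mathbb{K}$. Then central extensions of $(L,[-,-]_L,\delta)$ by $(V,\delta_V)$ are classified by the second cohomology group $\mathcal{H}^2_{\mathrm{InvDer}}(L;V)$ of the InvDer Lie algebra $(L,[-,-]_L,\delta)$ with coefficients in the trivial representation $(V;\rho=0,\delta_V)$.
   Context: $\mathbb{K}$ is a field of characteristic $0$; all vector spaces and algebras are over $\mathbb{K}$. A derivation of a Lie algebra $(L,[-,-]_L)$ is a linear map $\delta:L\to L$ with $\delta[x,y]_L=[\delta x,y]_L+[x,\delta y]_L$ for all $x,y\in L$. An Inv-derivation is an invertible derivation $\delta$ such that $[\delta x,\delta y]_L=\delta^2[x,y]_L$ for all $x,y\in L$. An InvDer Lie algebra $(L,[-,-]_L,\delta)$ is a Lie algebra equipped with an Inv-derivation $\delta$; it is abelian if its bracket is zero. A morphism of InvDer Lie algebras $(L_1,[-,-]_1,\delta_1)\to(L_2,[-,-]_2,\delta_2)$ is a Lie algebra homomorphism $\varphi$ with $\varphi\circ\delta_1=\delta_2\circ\varphi$. A central extension of $(L,[-,-]_L,\delta)$ by the abelian InvDer Lie algebra $(V,\delta_V)$ is an InvDer Lie algebra $(\widehat{L},[-,-]_{\widehat L},\widehat\delta)$ with a short exact sequence $0\to V\xrightarrow{i}\widehat{L}\xrightarrow{p}L\to0$ of InvDer Lie algebra morphisms such that $[V,\widehat{L}]_{\widehat L}=0$, where $V$ is identified with the corresponding subalgebra $i(V)$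 of $\widehat L$ (so $\widehat\delta|_V=\delta_V$). Two central extensions $(\widehat L_1,\widehat\delta_1)$ (with maps $i_1,p_1$) and $(\widehat L_2,\widehat\delta_2)$ (with maps $i_2,p_2$) are isomorphic if there is an InvDer Lie algebra morphism $\varphi:\widehat L_1\to\widehat L_2$ with $\varphi\circ i_1=i_2$ and $p_2\circ\varphi=p_1$. Cohomology with coefficients in the trivial representation $(V;\rho=0,\delta_V)$: $2$-cochains are triples $(f,g,h)\in\mathrm{Hom}(\wedge^2L,V)\oplus\mathrm{Hom}(L,V)\oplus\mathrm{Hom}(L,V)$. A $2$-cochain $(f,g,h)$ is a $2$-cocycle if for all $x,y,z\in L$ $$f([x,y]_L,z)+f([y,z]_L,x)+f([z,x]_L,y)=0,$$ $$g([x,y]_L)+\delta_Vf(x,y)-f(\delta x,y)-f(x,\delta y)=0,$$ $$h(\delta[x,y]_L)+\delta_Vh([x,y]_L)+\delta_V^2f(x,y)-f(\delta x,\delta y)=0.$$ For $\Phi\in\mathrm{Hom}(L,V)$ the coboundary is $\mathfrak{D}^1_{\mathrm{InvDer}}(\Phi)=(f_\Phi,g_\Phi,g_\Phi)$ with $f_\Phi(x,y)=-\Phi([x,y]_L)$ and $g_\Phi(x)=\delta_V\Phi(x)-\Phi(\delta x)$. $\mathcal{H}^2_{\mathrm{InvDer}}(L;V)$ is the quotient of the space of all $2$-cocycles by the space of all $2$-coboundaries $\mathfrak{D}^1_{\mathrm{InvDer}}(\Phi)$.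
   Formalization: The bijection is with the classes in H² represented by cocycles (f,g,g), not with all of H²: for L=V=K, δ=1, δ_V=2 there is one isomorphism class of central extensions, while H² is one-dimensional. *)

theory Defs
  imports Complex_Main "HOL-Library.Function_Algebras" "HOL-Library.Product_Plus"
begin

text \<open>The underlying abelian group is the whole carrier type; the scalar action over the field
  \<open>'k\<close> is a component of the structure.\<close>

record ('k, 'a) invder_struct =
  scale :: "'k \<Rightarrow> 'a \<Rightarrow> 'a"
  bracket :: "'a \<Rightarrow> 'a \<Rightarrow> 'a"
  der :: "'a \<Rightarrow> 'a"

locale lie_algebra =
  fixes L :: "('k::field_char_0, 'a::ab_group_add) invder_struct"
  assumes vector_space: "vector_space (scale L)"
    and bracket_linear_left: "\<And>y. Vector_Spaces.linear (scale L) (scale L) (\<lambda>x. bracket L x y)"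
    and bracket_linear_right: "\<And>x. Vector_Spaces.linear (scale L) (scale L) (\<lambda>y. bracket L x y)"
    and bracket_alternating: "\<And>x. bracket L x x = 0"
    and jacobi: "\<And>x y z. bracket L (bracket L x y) z + bracket L (bracket L y z) x
                   + bracket L (bracket L z x) y = 0"

definition derivation ::
  "('k::field_char_0, 'a::ab_group_add) invder_struct \<Rightarrow> ('a \<Rightarrow> 'a) \<Rightarrow> bool" where
  "derivation L d \<longleftrightarrow> Vector_Spaces.linear (scale L) (scale L) d \<and>
     (\<forall>x y. d (bracket L x y) = bracket L (d x) y + bracket L x (d y))"

definition inv_derivation ::
  "('k::field_char_0, 'a::ab_group_add) invder_struct \<Rightarrow> ('a \<Rightarrow> 'a) \<Rightarrow> bool" where
  "inv_derivation L d \<longleftrightarrow> derivation L d \<and> bij d \<and>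
     (\<forall>x y. bracket L (d x) (d y) = d (d (bracket L x y)))"

locale invder_lie_algebra = lie_algebra L
  for L :: "('k::field_char_0, 'a::ab_group_add) invder_struct" +
  assumes inv_derivation_der: "inv_derivation L (der L)"

definition abelian :: "('k, 'a::ab_group_add) invder_struct \<Rightarrow> bool" where
  "abelian L \<longleftrightarrow> (\<forall>x y. bracket L x y = 0)"

definition invder_morphism ::
  "('k::field_char_0, 'a::ab_group_add) invder_struct \<Rightarrow> ('k, 'b::ab_group_add) invder_struct
     \<Rightarrow> ('a \<Rightarrow> 'b) \<Rightarrow> bool" where
  "invder_morphism A B \<phi> \<longleftrightarrow> Vector_Spaces.linear (scale A) (scale B) \<phi> \<and>
     (\<forall>x y. \<phi> (bracket A x y) = bracket B (\<phi> x) (\<phi> y)) \<and> (\<forall>x. \<phi> (der A x) = der B (\<phi> x))"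

record ('k, 'v, 'l, 'e) extension =
  total :: "('k, 'e) invder_struct"
  incl :: "'v \<Rightarrow> 'e"
  proj :: "'e \<Rightarrow> 'l"

definition central_extension ::
  "('k::field_char_0, 'l::ab_group_add) invder_struct \<Rightarrow> ('k, 'v::ab_group_add) invder_struct
     \<Rightarrow> ('k, 'v, 'l, 'e::ab_group_add) extension \<Rightarrow> bool" where
  "central_extension L V E \<longleftrightarrow>
     invder_lie_algebra (total E) \<and>
     invder_morphism V (total E) (incl E) \<and> invder_morphism (total E) L (proj E) \<and>
     inj (incl E) \<and> range (incl E) = {e. proj E e = 0} \<and> surj (proj E) \<and>
     (\<forall>v e. bracket (total E) (incl E v) e = 0)"

definition ext_iso ::
  "('k::field_char_0, 'v, 'l, 'e1::ab_group_add) extension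
     \<Rightarrow> ('k, 'v, 'l, 'e2::ab_group_add) extension \<Rightarrow> bool" where
  "ext_iso E1 E2 \<longleftrightarrow> (\<exists>\<phi>. invder_morphism (total E1) (total E2) \<phi> \<and>
     \<phi> \<circ> incl E1 = incl E2 \<and> proj E2 \<circ> \<phi> = proj E1)"

definition ext_iso_rel ::
  "('k::field_char_0, 'l::ab_group_add) invder_struct \<Rightarrow> ('k, 'v::ab_group_add) invder_struct
     \<Rightarrow> ('k, 'v, 'l, 'e::ab_group_add) extension rel" where
  "ext_iso_rel L V =
     {(E1, E2). central_extension L V E1 \<and> central_extension L V E2 \<and> ext_iso E1 E2}"

type_synonym ('l, 'v) cochain2 = "('l \<Rightarrow> 'l \<Rightarrow> 'v) \<times> ('l \<Rightarrow> 'v) \<times> ('l \<Rightarrow> 'v)"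

definition cochains2 ::
  "('k::field_char_0, 'l::ab_group_add) invder_struct \<Rightarrow> ('k, 'v::ab_group_add) invder_struct
     \<Rightarrow> ('l, 'v) cochain2 set" where
  "cochains2 L V = {(f, g, h).
     (\<forall>y. Vector_Spaces.linear (scale L) (scale V) (\<lambda>x. f x y)) \<and>
     (\<forall>x. Vector_Spaces.linear (scale L) (scale V) (\<lambda>y. f x y)) \<and>
     (\<forall>x. f x x = 0) \<and>
     Vector_Spaces.linear (scale L) (scale V) g \<and>
     Vector_Spaces.linear (scale L) (scale V) h}"

definition cocycles2 ::
  "('k::field_char_0, 'l::ab_group_add) invder_struct \<Rightarrow> ('k, 'v::ab_group_add) invder_struct
     \<Rightarrow> ('l, 'v) cochain2 set" where
  "cocycles2 L V = {(f, g, h). (f, g, h) \<in> cochains2 L V \<and>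
     (\<forall>x y z. f (bracket L x y) z + f (bracket L y z) x + f (bracket L z x) y = 0) \<and>
     (\<forall>x y. g (bracket L x y) + der V (f x y) - f (der L x) y - f x (der L y) = 0) \<and>
     (\<forall>x y. h (der L (bracket L x y)) + der V (h (bracket L x y)) + der V (der V (f x y))
              - f (der L x) (der L y) = 0)}"

definition coboundary1 ::
  "('k::field_char_0, 'l::ab_group_add) invder_struct \<Rightarrow> ('k, 'v::ab_group_add) invder_struct
     \<Rightarrow> ('l \<Rightarrow> 'v) \<Rightarrow> ('l, 'v) cochain2" where
  "coboundary1 L V \<Phi> =
     (\<lambda>x y. - \<Phi> (bracket L x y),
      \<lambda>x. der V (\<Phi> x) - \<Phi> (der L x),
      \<lambda>x. der V (\<Phi> x) - \<Phi> (der L x))"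

definition coboundaries2 ::
  "('k::field_char_0, 'l::ab_group_add) invder_struct \<Rightarrow> ('k, 'v::ab_group_add) invder_struct
     \<Rightarrow> ('l, 'v) cochain2 set" where
  "coboundaries2 L V =
     coboundary1 L V ` {\<Phi>. Vector_Spaces.linear (scale L) (scale V) \<Phi>}"

text \<open>The difference of cochains below is the componentwise, pointwise one.\<close>

definition cohomologous ::
  "('k::field_char_0, 'l::ab_group_add) invder_struct \<Rightarrow> ('k, 'v::ab_group_add) invder_struct
     \<Rightarrow> ('l, 'v) cochain2 rel" where
  "cohomologous L V =
     {(c, c'). c \<in> cocycles2 L V \<and> c' \<in> cocycles2 L V \<and> c' - c \<in> coboundaries2 L V}"

definition H2 ::
  "('k::field_char_0, 'l::ab_group_add) invder_struct \<Rightarrow> ('k, 'v::ab_group_add) invder_struct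
     \<Rightarrow> ('l, 'v) cochain2 set set" where
  "H2 L V = cocycles2 L V // cohomologous L V"

definition linear_section ::
  "('k::field_char_0, 'l::ab_group_add) invder_struct
     \<Rightarrow> ('k, 'v, 'l, 'e::ab_group_add) extension \<Rightarrow> ('l \<Rightarrow> 'e) \<Rightarrow> bool" where
  "linear_section L E s \<longleftrightarrow>
     Vector_Spaces.linear (scale L) (scale (total E)) s \<and> (\<forall>x. proj E (s x) = x)"

text \<open>The failure of a section to be a morphism. There are two maps only, one measuring the
  bracket and one the derivation. Applying \<open>der\<close> twice shows that the identity
  \<open>[\<delta> x, \<delta> y] = \<delta>\<^sup>2 [x, y]\<close> in the extension is the third cocycle equation
  with \<open>h = g\<close>, so the derivation defect occupies both linear slots of the cochain.\<close>

definition section_cocycle ::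
  "('k::field_char_0, 'l::ab_group_add) invder_struct
     \<Rightarrow> ('k, 'v, 'l, 'e::ab_group_add) extension \<Rightarrow> ('l \<Rightarrow> 'e) \<Rightarrow> ('l, 'v) cochain2" where
  "section_cocycle L E s =
     (let f = (\<lambda>x y. inv (incl E) (bracket (total E) (s x) (s y) - s (bracket L x y)));
          g = (\<lambda>x. inv (incl E) (der (total E) (s x) - s (der L x)))
      in (f, g, g))"

definition ext_class ::
  "('k::field_char_0, 'l::ab_group_add) invder_struct \<Rightarrow> ('k, 'v::ab_group_add) invder_struct
     \<Rightarrow> ('k, 'v, 'l, 'e::ab_group_add) extension \<Rightarrow> ('l, 'v) cochain2 set" where
  "ext_class L V E =
     cohomologous L V `` {section_cocycle L E (SOME s. linear_section L E s)}"

text \<open>The classes in the image of \<open>ext_class\<close> are those represented by a cocycle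
  \<open>(f, g, g)\<close>. They need not exhaust \<open>H2 L V\<close>: if \<open>L\<close> and \<open>V\<close> are one-dimensional
  with \<open>der L = id\<close> and \<open>der V = 2 id\<close>, then all central extensions are isomorphic, whereas
  the cocycles are all \<open>(0, g, h)\<close>, the coboundaries are the \<open>(0, g, g)\<close>, and \<open>H2 L V\<close> is
  one-dimensional.\<close>

definition H2_diag ::
  "('k::field_char_0, 'l::ab_group_add) invder_struct \<Rightarrow> ('k, 'v::ab_group_add) invder_struct
     \<Rightarrow> ('l, 'v) cochain2 set set" where
  "H2_diag L V = {c \<in> H2 L V. \<exists>f g. (f, g, g) \<in> c}"

end

theory Submission
  imports Defs
begin

text \<open>A central extension splits linearly; the failure of a linear section \<open>s\<close> to commute with the
  brackets and the derivations takes values in the kernel \<open>V\<close> and is a cocycle \<open>(f, g, g)\<close>: the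
  three cocycle equations are the Jacobi identity, the Leibniz rule and \<open>[\<delta> a, \<delta> b] = \<delta>\<^sup>2 [a, b]\<close>
  evaluated on the image of \<open>s\<close>. Any two sections differ by a linear map \<open>\<Phi>: L \<rightarrow> V\<close>, which
  changes the cocycle by the coboundary of \<open>\<Phi>\<close>, so an extension realises every cocycle of its
  class. Sections with equal cocycles give an isomorphism by matching the decompositions
  \<open>i v + s x\<close>, and conversely an isomorphism transports a section together with its cocycle. Finally
  every \<open>(f, g, g)\<close> is realised by twisting the bracket and the derivation of \<open>V \<times> L\<close>.\<close>

section \<open>Linear maps and rewriting rules for brackets and derivations\<close>

lemma linearI:
  assumes "vector_space s" "vector_space t" "\<And>x y. f (x + y) = f x + f y" "\<And>c x. f (s c x) = t c (f x)"
  shows "Vector_Spaces.linear s t f"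
  using assms by (simp add: Vector_Spaces.linear_iff)

text \<open>Linearity is a premise rather than a locale assumption, so that \<open>OF\<close> turns
  any linear map into a set of rewrite rules.\<close>

lemma
  assumes "Vector_Spaces.linear s t f"
  shows linear_map_add: "f (x + y) = f x + f y"
    and linear_map_diff: "f (x - y) = f x - f y"
    and linear_map_minus: "f (- x) = - f x"
    and linear_map_zero: "f 0 = 0"
    and linear_map_scale: "f (s c x) = t c (f x)"
proof -
  interpret Vector_Spaces.linear s t f by fact
  show "f (x + y) = f x + f y" "f (x - y) = f x - f y" "f (- x) = - f x" "f 0 = 0"
    "f (s c x) = t c (f x)"
    by (simp_all add: add diff neg scale)
qed

lemmas linear_map_simps =
  linear_map_add linear_map_diff linear_map_minus linear_map_zero linear_map_scale

context lie_algebra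
begin

lemmas bracket_simps =
  linear_map_simps[OF bracket_linear_left] linear_map_simps[OF bracket_linear_right]
  bracket_alternating

lemma bracket_antisym: "bracket L x y = - bracket L y x"
proof -
  have "0 = bracket L (x + y) (x + y)"
    by (simp only: bracket_alternating)
  also have "\<dots> = bracket L x (x + y) + bracket L y (x + y)"
    by (rule linear_map_add[OF bracket_linear_left])
  also have "\<dots> = bracket L x y + bracket L y x"
    by (simp add: linear_map_add[OF bracket_linear_right] bracket_alternating)
  finally show ?thesis
    by (simp add: eq_neg_iff_add_eq_0)
qed

end

context invder_lie_algebra
begin

lemma der_linear: "Vector_Spaces.linear (scale L) (scale L) (der L)"
  and der_bracket: "der L (bracket L x y) = bracket L (der L x) y + bracket L x (der L y)"
  and der_bij: "bij (der L)"
  and bracket_der_der: "bracket L (der L x) (der L y) = der L (der L (bracket L x y))"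
  using inv_derivation_der by (auto simp: inv_derivation_def derivation_def)

lemmas der_simps = linear_map_simps[OF der_linear]

end

section \<open>Coboundaries and cohomologous cocycles\<close>

locale invder_pair = L: invder_lie_algebra L + V: invder_lie_algebra V
  for L :: "('k::field_char_0, 'l::ab_group_add) invder_struct"
    and V :: "('k, 'v::ab_group_add) invder_struct" +
  assumes abelian: "abelian V"
begin

text \<open>\<open>coboundary1\<close> is additive in \<open>\<Phi>\<close> because
  \<open>der V\<close> is, so its image on linear maps is a subgroup. The three closure properties
  yield reflexivity, symmetry and transitivity of \<open>cohomologous\<close>.\<close>

lemma
  shows coboundaries2_zero: "0 \<in> coboundaries2 L V"
    and coboundaries2_minus: "b \<in> coboundaries2 L V \<Longrightarrow> - b \<in> coboundaries2 L V"
    and coboundaries2_add: "b \<in> coboundaries2 L V \<Longrightarrow> b' \<in> coboundaries2 L V \<Longrightarrow>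
      b + b' \<in> coboundaries2 L V"
proof -
  interpret LV: vector_space_pair "scale L" "scale V"
    by (simp add: vector_space_pair_def L.vector_space V.vector_space)
  note hom = LV.module_hom_zero LV.module_hom_add LV.module_hom_neg
  have "0 = coboundary1 L V (\<lambda>_. 0)"
    by (simp add: coboundary1_def zero_prod_def zero_fun_def V.der_simps)
  then show "0 \<in> coboundaries2 L V"
    using hom by (auto simp: coboundaries2_def module_hom_iff_linear)
  have "- coboundary1 L V \<Phi> = coboundary1 L V (\<lambda>x. - \<Phi> x)" for \<Phi>
    by (simp add: coboundary1_def fun_eq_iff V.der_simps)
  then show "b \<in> coboundaries2 L V \<Longrightarrow> - b \<in> coboundaries2 L V"
    using hom by (auto simp: coboundaries2_def module_hom_iff_linear)
  have "coboundary1 L V \<Phi> + coboundary1 L V \<Psi> = coboundary1 L V (\<lambda>x. \<Phi> x + \<Psi> x)" for \<Phi> \<Psi>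
    by (simp add: coboundary1_def fun_eq_iff V.der_simps)
  then show "b \<in> coboundaries2 L V \<Longrightarrow> b' \<in> coboundaries2 L V \<Longrightarrow> b + b' \<in> coboundaries2 L V"
    using hom by (auto simp: coboundaries2_def module_hom_iff_linear)
qed

lemma equiv_cohomologous: "equiv (cocycles2 L V) (cohomologous L V)"
proof (rule equivI)
  show "cohomologous L V \<subseteq> cocycles2 L V \<times> cocycles2 L V"
    by (auto simp: cohomologous_def)
  show "refl_on (cocycles2 L V) (cohomologous L V)"
    by (auto simp: refl_on_def cohomologous_def coboundaries2_zero)
  show "sym (cohomologous L V)"
    using coboundaries2_minus by (fastforce simp: sym_def cohomologous_def)
  show "trans (cohomologous L V)"
  proof (rule transI)
    fix a b c assume "(a, b) \<in> cohomologous L V" "(b, c) \<in> cohomologous L V"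
    moreover have "c - a = (b - a) + (c - b)" by simp
    ultimately show "(a, c) \<in> cohomologous L V"
      by (simp only: cohomologous_def mem_Collect_eq case_prod_conv) (metis coboundaries2_add)
  qed
qed

end

section \<open>Linear sections of a central extension and their cocycles\<close>

locale invder_central_extension = invder_pair L V
  for L :: "('k::field_char_0, 'l::ab_group_add) invder_struct"
    and V :: "('k, 'v::ab_group_add) invder_struct" +
  fixes E :: "('k, 'v, 'l, 'e::ab_group_add) extension"
  assumes central_extension: "central_extension L V E"

sublocale invder_central_extension \<subseteq> E: invder_lie_algebra "total E"
  using central_extension by (simp add: central_extension_def)

context invder_central_extension
begin

lemma incl_linear: "Vector_Spaces.linear (scale V) (scale (total E)) (incl E)"
  and incl_der: "incl E (der V v) = der (total E) (incl E v)"
  and proj_linear: "Vector_Spaces.linear (scale (total E)) (scale L) (proj E)"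
  and proj_bracket: "proj E (bracket (total E) a b) = bracket L (proj E a) (proj E b)"
  and proj_der: "proj E (der (total E) a) = der L (proj E a)"
  and incl_inj: "inj (incl E)"
  and range_incl: "range (incl E) = {e. proj E e = 0}"
  and proj_surj: "surj (proj E)"
  and incl_central_left: "bracket (total E) (incl E v) a = 0"
  using central_extension by (auto simp: central_extension_def invder_morphism_def)

lemma incl_central_right: "bracket (total E) a (incl E v) = 0"
  using E.bracket_antisym[of a "incl E v"] by (simp add: incl_central_left)

lemma proj_incl: "proj E (incl E v) = 0"
  using range_incl by auto

lemma incl_inv: "proj E a = 0 \<Longrightarrow> incl E (inv (incl E) a) = a"
  using range_incl by (metis (mono_tags) f_inv_into_f mem_Collect_eq)

lemma incl_eq_iff: "incl E u = incl E v \<longleftrightarrow> u = v"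
  using incl_inj by (rule inj_eq)

lemmas incl_simps = linear_map_simps[OF incl_linear] incl_der incl_central_left
  incl_central_right proj_incl

lemmas proj_simps = linear_map_simps[OF proj_linear] proj_bracket proj_der

text \<open>A surjective linear map between vector spaces has a linear right inverse.\<close>

lemma ex_linear_section: "\<exists>s. linear_section L E s"
proof -
  interpret vector_space_pair "scale (total E)" "scale L"
    by (simp add: vector_space_pair_def L.vector_space E.vector_space)
  show ?thesis
    using linear_surjective_right_inverse[OF proj_linear proj_surj]
    by (auto simp: linear_section_def fun_eq_iff)
qed

text \<open>Since \<open>proj E\<close> is a morphism, both defects of \<open>s\<close> lie in its
  kernel, where \<open>inv (incl E)\<close> can be traded for an equation in the total space. Later
  arguments compute with these two equations and recognise a cocycle by them.\<close>

lemma section_cocycle_iff: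
  assumes s: "linear_section L E s"
  shows "section_cocycle L E s = (f, g, h) \<longleftrightarrow> h = g \<and>
    (\<forall>x y. bracket (total E) (s x) (s y) = s (bracket L x y) + incl E (f x y)) \<and>
    (\<forall>x. der (total E) (s x) = s (der L x) + incl E (g x))"
proof -
  have ps: "proj E (s x) = x" for x
    using s by (simp add: linear_section_def)
  have inv: "inv (incl E) (a - b) = v \<longleftrightarrow> a = b + incl E v" if "proj E a = proj E b" for a b v
  proof -
    have "incl E (inv (incl E) (a - b)) = a - b"
      using that by (simp add: incl_inv proj_simps)
    then have "inv (incl E) (a - b) = v \<longleftrightarrow> a - b = incl E v"
      using incl_eq_iff[of "inv (incl E) (a - b)" v] by simp
    then show ?thesis by (auto simp: algebra_simps)
  qed
  show ?thesis
    unfolding section_cocycle_def Let_def prod.inject fun_eq_iff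
    by (auto simp: inv ps proj_simps incl_eq_iff)
qed

lemma section_cocycleE:
  assumes s: "linear_section L E s"
  obtains f g where "section_cocycle L E s = (f, g, g)"
    "\<And>x y. bracket (total E) (s x) (s y) = s (bracket L x y) + incl E (f x y)"
    "\<And>x. der (total E) (s x) = s (der L x) + incl E (g x)"
proof -
  obtain f g h where c: "section_cocycle L E s = (f, g, h)"
    by (cases "section_cocycle L E s")
  then show ?thesis
    using section_cocycle_iff[OF s, of f g h] that by auto
qed

text \<open>Injectivity of \<open>incl E\<close> lets each identity in \<open>V\<close> be tested in
  the total space, where it becomes an identity between section values.\<close>

lemma section_cocycle_in_cocycles2:
  assumes s: "linear_section L E s"
  shows "section_cocycle L E s \<in> cocycles2 L V"
proof -
  obtain f g where c: "section_cocycle L E s = (f, g, g)"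
    and br: "\<And>x y. bracket (total E) (s x) (s y) = s (bracket L x y) + incl E (f x y)"
    and d: "\<And>x. der (total E) (s x) = s (der L x) + incl E (g x)"
    using section_cocycleE[OF s] by blast
  have lin: "Vector_Spaces.linear (scale L) (scale (total E)) s"
    using s by (simp add: linear_section_def)
  note s_simps = linear_map_simps[OF lin]
  have f: "incl E (f x y) = bracket (total E) (s x) (s y) - s (bracket L x y)" for x y
    by (simp add: br)
  have g: "incl E (g x) = der (total E) (s x) - s (der L x)" for x
    by (simp add: d)
  interpret E': module "scale (total E)"
    using E.vector_space by (simp add: module_iff_vector_space)
  note eqs = incl_eq_iff[symmetric] incl_simps f g s_simps L.bracket_simps E.bracket_simps
    L.der_simps E.der_simps E'.scale_right_diff_distrib
  have "Vector_Spaces.linear (scale L) (scale V) (\<lambda>x. f x y)" for y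
    by (intro linearI L.vector_space V.vector_space) (simp_all add: eqs)
  moreover have "Vector_Spaces.linear (scale L) (scale V) (\<lambda>y. f x y)" for x
    by (intro linearI L.vector_space V.vector_space) (simp_all add: eqs)
  moreover have "Vector_Spaces.linear (scale L) (scale V) g"
    by (intro linearI L.vector_space V.vector_space) (simp_all add: eqs)
  moreover have "f x x = 0" for x
    by (simp add: eqs)
  moreover have "f (bracket L x y) z + f (bracket L y z) x + f (bracket L z x) y = 0" for x y z
  proof -
    \<comment> \<open>The inner bracket differs from \<open>s (bracket L x y)\<close> by a central
      element, which the outer bracket kills. The cyclic sum of the \<open>f\<close> terms is thus a
      difference of two Jacobi sums.\<close>
    have "incl E (f (bracket L x y) z) =
      bracket (total E) (bracket (total E) (s x) (s y)) (s z) - s (bracket L (bracket L x y) z)"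
      for x y z
      by (simp add: br E.bracket_simps incl_simps)
    then have "incl E (f (bracket L x y) z + f (bracket L y z) x + f (bracket L z x) y) =
      (bracket (total E) (bracket (total E) (s x) (s y)) (s z)
        + bracket (total E) (bracket (total E) (s y) (s z)) (s x)
        + bracket (total E) (bracket (total E) (s z) (s x)) (s y))
      - s (bracket L (bracket L x y) z + bracket L (bracket L y z) x + bracket L (bracket L z x) y)"
      by (simp add: incl_simps s_simps)
    also have "\<dots> = incl E 0"
      by (simp only: E.jacobi L.jacobi s_simps incl_simps diff_self)
    finally show ?thesis by (simp only: incl_eq_iff)
  qed
  moreover have "g (bracket L x y) + der V (f x y) - f (der L x) y - f x (der L y) = 0" for x y
  proof -
    have "der (total E) (bracket (total E) (s x) (s y)) =
      bracket (total E) (der (total E) (s x)) (s y) + bracket (total E) (s x) (der (total E) (s y))"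
      by (rule E.der_bracket)
    then have "incl E (g (bracket L x y) + der V (f x y) - f (der L x) y - f x (der L y)) = incl E 0"
      by (simp add: br d E.bracket_simps E.der_simps incl_simps s_simps L.der_bracket algebra_simps)
    then show ?thesis by (simp only: incl_eq_iff)
  qed
  moreover have "g (der L (bracket L x y)) + der V (g (bracket L x y)) + der V (der V (f x y))
      - f (der L x) (der L y) = 0" for x y
  proof -
    have "bracket (total E) (der (total E) (s x)) (der (total E) (s y)) =
      der (total E) (der (total E) (bracket (total E) (s x) (s y)))"
      by (rule E.bracket_der_der)
    \<comment> \<open>On the right the first \<open>der\<close> produces
      \<open>g (bracket L x y)\<close>; the second maps it by \<open>der V\<close> and adds
      \<open>g (der L (bracket L x y))\<close>. So \<open>g\<close> takes the place of
      \<open>h\<close>.\<close>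
    then have "incl E (g (der L (bracket L x y)) + der V (g (bracket L x y)) + der V (der V (f x y))
      - f (der L x) (der L y)) = incl E 0"
      by (simp add: br d E.bracket_simps E.der_simps incl_simps s_simps L.bracket_der_der algebra_simps)
    then show ?thesis by (simp only: incl_eq_iff)
  qed
  ultimately show ?thesis
    by (simp add: c cocycles2_def cochains2_def)
qed

text \<open>A central shift leaves brackets of section values unchanged but moves
  \<open>s (bracket L x y)\<close> by \<open>\<Phi> (bracket L x y)\<close>, whence the minus sign
  in \<open>coboundary1\<close>. The derivation defect gains \<open>der V (\<Phi> x)\<close> and
  loses \<open>\<Phi> (der L x)\<close>.\<close>

lemma linear_section_translate:
  assumes s: "linear_section L E s" and \<Phi>: "Vector_Spaces.linear (scale L) (scale V) \<Phi>"
  defines "s' \<equiv> \<lambda>x. s x + incl E (\<Phi> x)"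
  shows "linear_section L E s'"
    and "section_cocycle L E s' = section_cocycle L E s + coboundary1 L V \<Phi>"
proof -
  have lin: "Vector_Spaces.linear (scale L) (scale (total E)) s"
    using s by (simp add: linear_section_def)
  interpret E': module "scale (total E)"
    using E.vector_space by (simp add: module_iff_vector_space)
  show s': "linear_section L E s'"
    using s unfolding linear_section_def s'_def
    by (auto intro!: linearI L.vector_space E.vector_space
        simp: linear_map_simps[OF lin] linear_map_simps[OF \<Phi>] incl_simps proj_simps
          E'.scale_right_distrib)
  obtain f g where c: "section_cocycle L E s = (f, g, g)"
    and br: "\<And>x y. bracket (total E) (s x) (s y) = s (bracket L x y) + incl E (f x y)"
    and d: "\<And>x. der (total E) (s x) = s (der L x) + incl E (g x)"
    using section_cocycleE[OF s] by blast
  show "section_cocycle L E s' = section_cocycle L E s + coboundary1 L V \<Phi>"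
    unfolding c coboundary1_def add_Pair section_cocycle_iff[OF s']
    by (simp add: s'_def br d E.bracket_simps E.der_simps incl_simps)
qed

text \<open>The difference of two sections is killed by \<open>proj E\<close>, so it pulls back
  along \<open>incl E\<close> to a linear \<open>\<Phi>\<close>, and translation by
  \<open>\<Phi>\<close> carries one section to the other.\<close>

lemma section_cocycles_cohomologous:
  assumes s: "linear_section L E s" and s': "linear_section L E s'"
  shows "(section_cocycle L E s, section_cocycle L E s') \<in> cohomologous L V"
proof -
  define \<Phi> where "\<Phi> x = inv (incl E) (s' x - s x)" for x
  have lin: "Vector_Spaces.linear (scale L) (scale (total E)) s"
    "Vector_Spaces.linear (scale L) (scale (total E)) s'"
    using s s' by (simp_all add: linear_section_def)
  interpret E': module "scale (total E)"
    using E.vector_space by (simp add: module_iff_vector_space)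
  have incl_\<Phi>: "incl E (\<Phi> x) = s' x - s x" for x
    unfolding \<Phi>_def by (rule incl_inv) (use s s' in \<open>simp add: proj_simps linear_section_def\<close>)
  have \<Phi>: "Vector_Spaces.linear (scale L) (scale V) \<Phi>"
    by (intro linearI L.vector_space V.vector_space)
      (simp_all add: incl_eq_iff[symmetric] incl_simps incl_\<Phi> linear_map_simps[OF lin(1)]
        linear_map_simps[OF lin(2)] E'.scale_right_diff_distrib)
  have "section_cocycle L E s' = section_cocycle L E s + coboundary1 L V \<Phi>"
    using linear_section_translate(2)[OF s \<Phi>] by (simp add: incl_\<Phi>)
  then show ?thesis
    using \<Phi> section_cocycle_in_cocycles2[OF s] section_cocycle_in_cocycles2[OF s']
    by (auto simp: cohomologous_def coboundaries2_def)
qed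

text \<open>Removes the arbitrary choice in \<open>ext_class\<close>: any section may serve.\<close>

lemma ext_class_eq:
  assumes "linear_section L E s"
  shows "ext_class L V E = cohomologous L V `` {section_cocycle L E s}"
  unfolding ext_class_def
  by (intro equiv_class_eq[OF equiv_cohomologous] section_cocycles_cohomologous assms
      someI_ex[OF ex_linear_section])

lemma ext_class_in_H2_diag: "ext_class L V E \<in> H2_diag L V"
proof -
  obtain s where s: "linear_section L E s"
    using ex_linear_section ..
  obtain f g where "section_cocycle L E s = (f, g, g)"
    by (rule section_cocycleE[OF s]) (rule that)
  then show ?thesis
    using section_cocycle_in_cocycles2[OF s] section_cocycles_cohomologous[OF s s]
    by (auto simp: ext_class_eq[OF s] H2_diag_def H2_def intro: quotientI)
qed

text \<open>A coboundary is absorbed by translating the section. Hence two extensions of the same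
  class admit sections with literally equal cocycles.\<close>

lemma mem_ext_classE:
  assumes "c \<in> ext_class L V E"
  obtains s where "linear_section L E s" "section_cocycle L E s = c"
proof -
  obtain s where s: "linear_section L E s"
    using ex_linear_section ..
  then obtain \<Phi> where \<Phi>: "Vector_Spaces.linear (scale L) (scale V) \<Phi>"
    and "c - section_cocycle L E s = coboundary1 L V \<Phi>"
    using assms by (auto simp: ext_class_eq[OF s] cohomologous_def coboundaries2_def)
  then have "section_cocycle L E s + coboundary1 L V \<Phi> = c"
    by (simp add: algebra_simps)
  then show ?thesis
    using linear_section_translate[OF s \<Phi>] that by simp
qed

end

section \<open>Isomorphic extensions and equal classes\<close>

context invder_pair
begin

text \<open>The morphism carries a section of \<open>E1\<close> to a section of \<open>E2\<close>;
  as it is the identity on \<open>V\<close>, the defects \<open>f\<close> and \<open>g\<close> are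
  transported unchanged.\<close>

lemma ext_iso_imp_ext_class_eq:
  assumes E1: "central_extension L V E1" and E2: "central_extension L V E2"
    and iso: "ext_iso E1 E2"
  shows "ext_class L V E1 = ext_class L V E2"
proof -
  interpret E1: invder_central_extension L V E1 by unfold_locales fact
  interpret E2: invder_central_extension L V E2 by unfold_locales fact
  obtain \<phi> where \<phi>: "invder_morphism (total E1) (total E2) \<phi>"
    and comm: "\<phi> \<circ> incl E1 = incl E2" "proj E2 \<circ> \<phi> = proj E1"
    using iso by (auto simp: ext_iso_def)
  have lin: "Vector_Spaces.linear (scale (total E1)) (scale (total E2)) \<phi>"
    using \<phi> by (simp add: invder_morphism_def)
  obtain s where s: "linear_section L E1 s"
    using E1.ex_linear_section ..
  have s': "linear_section L E2 (\<phi> \<circ> s)"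
    using s comm(2) lin
    by (auto simp: linear_section_def fun_eq_iff intro: Vector_Spaces.linear_compose)
  obtain f g where c: "section_cocycle L E1 s = (f, g, g)"
    and br: "\<And>x y. bracket (total E1) (s x) (s y) = s (bracket L x y) + incl E1 (f x y)"
    and d: "\<And>x. der (total E1) (s x) = s (der L x) + incl E1 (g x)"
    using E1.section_cocycleE[OF s] by blast
  have "bracket (total E2) (\<phi> (s x)) (\<phi> (s y)) = \<phi> (s (bracket L x y)) + incl E2 (f x y)" for x y
    using \<phi> arg_cong[OF br[of x y], of \<phi>] comm(1)
    by (auto simp: invder_morphism_def linear_map_simps[OF lin] fun_eq_iff)
  moreover have "der (total E2) (\<phi> (s x)) = \<phi> (s (der L x)) + incl E2 (g x)" for x
    using \<phi> arg_cong[OF d[of x], of \<phi>] comm(1)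
    by (auto simp: invder_morphism_def linear_map_simps[OF lin] fun_eq_iff)
  ultimately have "section_cocycle L E2 (\<phi> \<circ> s) = (f, g, g)"
    by (simp add: E2.section_cocycle_iff[OF s'])
  then show ?thesis
    by (simp add: E1.ext_class_eq[OF s] E2.ext_class_eq[OF s'] c)
qed

text \<open>A section splits each total space into \<open>V\<close> and a copy of \<open>L\<close>,
  with operations determined by \<open>f\<close> and \<open>g\<close>. Equal cocycles mean equal
  operations in these coordinates.\<close>

lemma ext_isoI_section_cocycle:
  assumes E1: "central_extension L V E1" and E2: "central_extension L V E2"
    and s1: "linear_section L E1 s1" and s2: "linear_section L E2 s2"
    and eq: "section_cocycle L E1 s1 = section_cocycle L E2 s2"
  shows "ext_iso E1 E2"
proof -
  interpret E1: invder_central_extension L V E1 by unfold_locales fact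
  interpret E2: invder_central_extension L V E2 by unfold_locales fact
  obtain f g where c: "section_cocycle L E1 s1 = (f, g, g)"
    and br1: "\<And>x y. bracket (total E1) (s1 x) (s1 y) = s1 (bracket L x y) + incl E1 (f x y)"
    and d1: "\<And>x. der (total E1) (s1 x) = s1 (der L x) + incl E1 (g x)"
    using E1.section_cocycleE[OF s1] by blast
  have br2: "bracket (total E2) (s2 x) (s2 y) = s2 (bracket L x y) + incl E2 (f x y)"
    and d2: "der (total E2) (s2 x) = s2 (der L x) + incl E2 (g x)" for x y
    using c unfolding eq E2.section_cocycle_iff[OF s2] by auto
  have lin: "Vector_Spaces.linear (scale L) (scale (total E1)) s1"
    "Vector_Spaces.linear (scale L) (scale (total E2)) s2"
    using s1 s2 by (simp_all add: linear_section_def)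
  have ps: "proj E1 (s1 x) = x" "proj E2 (s2 x) = x" for x
    using s1 s2 by (simp_all add: linear_section_def)
  interpret M1: module "scale (total E1)"
    using E1.E.vector_space by (simp add: module_iff_vector_space)
  interpret M2: module "scale (total E2)"
    using E2.E.vector_space by (simp add: module_iff_vector_space)
  \<comment> \<open>The \<open>V\<close> coordinate of \<open>e\<close> is what remains after
    subtracting the section value over \<open>proj E1 e\<close>, an element of the kernel of
    \<open>proj E1\<close>.\<close>
  define \<phi> where "\<phi> e = incl E2 (inv (incl E1) (e - s1 (proj E1 e))) + s2 (proj E1 e)" for e
  have \<phi>: "\<phi> (incl E1 v + s1 x) = incl E2 v + s2 x" for v x
    by (simp add: \<phi>_def E1.proj_simps E1.proj_incl ps inv_f_f[OF E1.incl_inj])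
  have dec: "\<exists>v x. e = incl E1 v + s1 x" for e
    by (rule exI[of _ "inv (incl E1) (e - s1 (proj E1 e))"], rule exI[of _ "proj E1 e"])
      (simp add: E1.incl_inv E1.proj_simps ps)
  \<comment> \<open>The operations in coordinates: the coordinates on the right agree with those in
    \<open>comb2\<close>, so each morphism law for \<open>\<phi>\<close> becomes pure
    rewriting.\<close>
  have comb1: "(incl E1 u + s1 x) + (incl E1 v + s1 y) = incl E1 (u + v) + s1 (x + y)"
    "scale (total E1) k (incl E1 u + s1 x) = incl E1 (scale V k u) + s1 (scale L k x)"
    "bracket (total E1) (incl E1 u + s1 x) (incl E1 v + s1 y) = incl E1 (f x y) + s1 (bracket L x y)"
    "der (total E1) (incl E1 u + s1 x) = incl E1 (der V u + g x) + s1 (der L x)" for u v x y k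
    by (simp_all add: linear_map_simps[OF lin(1)] E1.incl_simps M1.scale_right_distrib
        E1.E.bracket_simps E1.E.der_simps br1 d1 ac_simps)
  have comb2: "(incl E2 u + s2 x) + (incl E2 v + s2 y) = incl E2 (u + v) + s2 (x + y)"
    "scale (total E2) k (incl E2 u + s2 x) = incl E2 (scale V k u) + s2 (scale L k x)"
    "bracket (total E2) (incl E2 u + s2 x) (incl E2 v + s2 y) = incl E2 (f x y) + s2 (bracket L x y)"
    "der (total E2) (incl E2 u + s2 x) = incl E2 (der V u + g x) + s2 (der L x)" for u v x y k
    by (simp_all add: linear_map_simps[OF lin(2)] E2.incl_simps M2.scale_right_distrib
        E2.E.bracket_simps E2.E.der_simps br2 d2 ac_simps)
  have "\<phi> (a + b) = \<phi> a + \<phi> b" for a b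
    using dec[of a] dec[of b] by (elim exE) (simp only: comb1 comb2 \<phi>)
  moreover have "\<phi> (scale (total E1) k a) = scale (total E2) k (\<phi> a)" for k a
    using dec[of a] by (elim exE) (simp only: comb1 comb2 \<phi>)
  moreover have "\<phi> (bracket (total E1) a b) = bracket (total E2) (\<phi> a) (\<phi> b)" for a b
    using dec[of a] dec[of b] by (elim exE) (simp only: comb1 comb2 \<phi>)
  moreover have "\<phi> (der (total E1) a) = der (total E2) (\<phi> a)" for a
    using dec[of a] by (elim exE) (simp only: comb1 comb2 \<phi>)
  ultimately have "invder_morphism (total E1) (total E2) \<phi>"
    unfolding invder_morphism_def
    by (auto intro!: linearI E1.E.vector_space E2.E.vector_space)
  moreover have "\<phi> \<circ> incl E1 = incl E2"
    using \<phi>[of _ 0] by (auto simp: fun_eq_iff linear_map_simps[OF lin(1)] linear_map_simps[OF lin(2)])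
  moreover have "proj E2 (\<phi> e) = proj E1 e" for e
    by (simp add: \<phi>_def E2.proj_simps E2.proj_incl ps)
  ultimately show ?thesis
    by (auto simp: ext_iso_def fun_eq_iff)
qed

lemma ext_iso_iff_ext_class_eq:
  assumes E1: "central_extension L V E1" and E2: "central_extension L V E2"
  shows "ext_iso E1 E2 \<longleftrightarrow> ext_class L V E1 = ext_class L V E2"
proof
  assume eq: "ext_class L V E1 = ext_class L V E2"
  interpret E1: invder_central_extension L V E1 by unfold_locales fact
  interpret E2: invder_central_extension L V E2 by unfold_locales fact
  obtain s2 where s2: "linear_section L E2 s2"
    using E2.ex_linear_section ..
  \<comment> \<open>Membership in the class of \<open>E1\<close> supplies a section of
    \<open>E1\<close> with exactly this cocycle.\<close>
  have "section_cocycle L E2 s2 \<in> ext_class L V E1"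
    unfolding eq E2.ext_class_eq[OF s2]
    using E2.section_cocycles_cohomologous[OF s2 s2] by simp
  then obtain s1 where "linear_section L E1 s1" "section_cocycle L E1 s1 = section_cocycle L E2 s2"
    by (rule E1.mem_ext_classE)
  then show "ext_iso E1 E2"
    using ext_isoI_section_cocycle[OF E1 E2] s2 by blast
qed (rule ext_iso_imp_ext_class_eq[OF E1 E2])

end

section \<open>Realising a cocycle by a twisted product\<close>

definition cocycle_extension ::
  "('k::field_char_0, 'l::ab_group_add) invder_struct \<Rightarrow> ('k, 'v::ab_group_add) invder_struct
    \<Rightarrow> ('l \<Rightarrow> 'l \<Rightarrow> 'v) \<Rightarrow> ('l \<Rightarrow> 'v) \<Rightarrow> ('k, 'v, 'l, 'v \<times> 'l) extension" where
  "cocycle_extension L V f g =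
    \<lparr>total = \<lparr>scale = (\<lambda>c (v, x). (scale V c v, scale L c x)),
       bracket = (\<lambda>(u, x) (v, y). (f x y, bracket L x y)),
       der = (\<lambda>(v, x). (der V v + g x, der L x))\<rparr>,
     incl = (\<lambda>v. (v, 0)), proj = snd\<rparr>"

context invder_pair
begin

text \<open>In the first coordinate the three cocycle equations are the Jacobi identity, the Leibniz
  rule and the Inv-derivation identity. The section sending \<open>x\<close> to
  \<open>(0, x)\<close> has defects \<open>f\<close> and \<open>g\<close>.\<close>

lemma
  assumes c: "(f, g, g) \<in> cocycles2 L V"
  shows central_extension_cocycle_extension: "central_extension L V (cocycle_extension L V f g)"
    and ext_class_cocycle_extension:
      "ext_class L V (cocycle_extension L V f g) = cohomologous L V `` {(f, g, g)}"
proof -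
  let ?E = "cocycle_extension L V f g"
  have sel [simp]: "scale (total ?E) k (v, x) = (scale V k v, scale L k x)"
    "bracket (total ?E) (u, x) (v, y) = (f x y, bracket L x y)"
    "der (total ?E) (v, x) = (der V v + g x, der L x)"
    "incl ?E v = (v, 0)" "proj ?E = snd" for k u v x y
    by (simp_all add: cocycle_extension_def)
  have lin: "\<And>y. Vector_Spaces.linear (scale L) (scale V) (\<lambda>x. f x y)"
    "\<And>x. Vector_Spaces.linear (scale L) (scale V) (\<lambda>y. f x y)"
    "Vector_Spaces.linear (scale L) (scale V) g"
    and alt: "\<And>x. f x x = 0"
    and jac: "\<And>x y z. f (bracket L x y) z + f (bracket L y z) x + f (bracket L z x) y = 0"
    and der1: "\<And>x y. g (bracket L x y) + der V (f x y) - f (der L x) y - f x (der L y) = 0"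
    and der2: "\<And>x y. g (der L (bracket L x y)) + der V (g (bracket L x y)) + der V (der V (f x y))
      - f (der L x) (der L y) = 0"
    using c by (auto simp: cocycles2_def cochains2_def)
  note lin_simps = lin[THEN linear_map_add] lin[THEN linear_map_scale] lin[THEN linear_map_zero]
  interpret SL: module "scale L"
    using L.vector_space by (simp add: module_iff_vector_space)
  interpret SV: module "scale V"
    using V.vector_space by (simp add: module_iff_vector_space)
  have vs: "vector_space (scale (total ?E))"
    by unfold_locales (auto simp: SL.scale_right_distrib SL.scale_left_distrib
        SV.scale_right_distrib SV.scale_left_distrib)
  have lie: "lie_algebra (total ?E)"
    by unfold_locales
      (auto intro!: linearI vs
        simp: lin_simps alt jac L.jacobi L.bracket_simps zero_prod_def SL.scale_right_distrib
          SL.scale_left_distrib SV.scale_right_distrib SV.scale_left_distrib)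
  \<comment> \<open>The map is triangular with bijective diagonal entries \<open>der V\<close> and
    \<open>der L\<close>: solve for the \<open>L\<close> coordinate first, then for the
    \<open>V\<close> coordinate after subtracting \<open>g x\<close>.\<close>
  have bij: "bij (der (total ?E))"
  proof (rule bijI')
    fix a b show "der (total ?E) a = der (total ?E) b \<longleftrightarrow> a = b"
      using V.der_bij L.der_bij by (cases a; cases b) (auto simp: bij_def inj_eq)
  next
    fix b :: "'v \<times> 'l"
    obtain u y where b: "b = (u, y)" by (cases b)
    obtain x where x: "y = der L x" using L.der_bij by (metis bij_pointE)
    obtain v where "u - g x = der V v" using V.der_bij by (metis bij_pointE)
    then have "b = der (total ?E) (v, x)" by (simp add: b x algebra_simps)
    then show "\<exists>a. b = der (total ?E) a" ..
  qed
  have "Vector_Spaces.linear (scale (total ?E)) (scale (total ?E)) (der (total ?E))"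
    by (auto intro!: linearI vs simp: lin_simps V.der_simps L.der_simps SV.scale_right_distrib)
  moreover have "f (der L x) y + f x (der L y) = der V (f x y) + g (bracket L x y)" for x y
    using der1[of x y] by (simp add: algebra_simps)
  moreover have "f (der L x) (der L y) =
      der V (der V (f x y)) + (der V (g (bracket L x y)) + g (der L (bracket L x y)))" for x y
    using der2[of x y] by (simp add: algebra_simps)
  ultimately have "inv_derivation (total ?E) (der (total ?E))"
    using bij by (auto simp: inv_derivation_def derivation_def L.der_bracket L.bracket_der_der
        V.der_simps add.assoc)
  with lie have "invder_lie_algebra (total ?E)"
    by (simp add: invder_lie_algebra_def invder_lie_algebra_axioms_def)
  \<comment> \<open>Abelianness of \<open>V\<close> enters here: it makes \<open>incl\<close>
    compatible with the brackets.\<close>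
  then show E: "central_extension L V ?E"
    using abelian
    by (auto simp: central_extension_def invder_morphism_def abelian_def lin_simps
        L.bracket_simps L.der_simps zero_prod_def inj_def image_def
        intro!: linearI vs L.vector_space V.vector_space)
  interpret invder_central_extension L V ?E by unfold_locales fact
  have s: "linear_section L ?E (\<lambda>x. (0, x))"
    by (auto simp: linear_section_def intro!: linearI vs L.vector_space)
  have "section_cocycle L ?E (\<lambda>x. (0, x)) = (f, g, g)"
    by (simp add: section_cocycle_iff[OF s] V.der_simps)
  then show "ext_class L V ?E = cohomologous L V `` {(f, g, g)}"
    by (simp add: ext_class_eq[OF s])
qed

text \<open>Any member of a class generates it, in particular the diagonal one, whose twisted
  product then has this class.\<close>

lemma H2_diag_ext_class:
  assumes "c \<in> H2_diag L V"
  obtains E :: "('k, 'v, 'l, 'v \<times> 'l) extension"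
  where "central_extension L V E" "ext_class L V E = c"
proof -
  obtain f g where c: "c \<in> cocycles2 L V // cohomologous L V" and fg: "(f, g, g) \<in> c"
    using assms by (auto simp: H2_diag_def H2_def)
  then have "(f, g, g) \<in> cocycles2 L V"
    using in_quotient_imp_subset[OF equiv_cohomologous] by blast
  moreover have "c = cohomologous L V `` {(f, g, g)}"
    using c fg by (metis Image_singleton_iff equiv_class_eq equiv_cohomologous quotientE)
  ultimately show ?thesis
    using that central_extension_cocycle_extension ext_class_cocycle_extension by metis
qed

section \<open>The bijection on isomorphism classes\<close>

text \<open>On central extensions the relation is equality of \<open>ext_class\<close>, so symmetry
  follows without inverting a morphism.\<close>

lemma equiv_ext_iso_rel:
  "equiv {E :: ('k, 'v, 'l, 'e::ab_group_add) extension. central_extension L V E} (ext_iso_rel L V)"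
proof -
  have "ext_iso_rel L V = {(E1 :: ('k, 'v, 'l, 'e) extension, E2). central_extension L V E1 \<and>
      central_extension L V E2 \<and> ext_class L V E1 = ext_class L V E2}"
    using ext_iso_iff_ext_class_eq by (fastforce simp: ext_iso_rel_def)
  then show ?thesis
    by (auto simp: equiv_def refl_on_def sym_def trans_def)
qed

text \<open>\<open>ext_class\<close> is constant on an isomorphism class, so \<open>the_elem\<close>
  extracts the value of the induced map on the quotient.\<close>

lemma the_ext_class:
  assumes E: "central_extension L V E"
  shows "the_elem (ext_class L V ` (ext_iso_rel L V `` {E})) = ext_class L V E"
proof -
  have "ext_class L V ` (ext_iso_rel L V `` {E}) = {ext_class L V E}"
    using E ext_iso_iff_ext_class_eq by (fastforce simp: ext_iso_rel_def)
  then show ?thesis by simp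
qed

lemma bij_betw_ext_class:
  "bij_betw (\<lambda>C. the_elem (ext_class L V ` C))
    ({E :: ('k, 'v, 'l, 'v \<times> 'l) extension. central_extension L V E} // ext_iso_rel L V)
    (H2_diag L V)"
proof -
  let ?X = "{E :: ('k, 'v, 'l, 'v \<times> 'l) extension. central_extension L V E}"
  have quot: "?X // ext_iso_rel L V = (\<lambda>E. ext_iso_rel L V `` {E}) ` ?X"
    by (auto simp: quotient_def)
  have "inj_on (\<lambda>C. the_elem (ext_class L V ` C)) (?X // ext_iso_rel L V)"
  proof (rule inj_onI, unfold quot, elim imageE, simp only: mem_Collect_eq the_ext_class)
    fix E1 E2 :: "('k, 'v, 'l, 'v \<times> 'l) extension"
    assume "central_extension L V E1" "central_extension L V E2"
      and "ext_class L V E1 = ext_class L V E2"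
    then have "(E1, E2) \<in> ext_iso_rel L V"
      by (simp add: ext_iso_rel_def ext_iso_iff_ext_class_eq)
    then show "ext_iso_rel L V `` {E1} = ext_iso_rel L V `` {E2}"
      by (rule equiv_class_eq[OF equiv_ext_iso_rel])
  qed
  moreover have "ext_class L V E \<in> H2_diag L V" if "E \<in> ?X" for E
  proof -
    interpret invder_central_extension L V E
      using that by unfold_locales simp
    show ?thesis by (rule ext_class_in_H2_diag)
  qed
  then have "(\<lambda>C. the_elem (ext_class L V ` C)) ` (?X // ext_iso_rel L V) = H2_diag L V"
    unfolding quot image_image
    by (auto simp: the_ext_class elim!: H2_diag_ext_class intro!: rev_image_eqI)
  ultimately show ?thesis by (simp add: bij_betw_def)
qed

end

text \<open>A set of extensions needs one fixed carrier type. The quotient is taken over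
  \<open>'v \<times> 'l\<close>, and the third conjunct shows that extensions on other carriers are
  represented there. The target is \<open>H2_diag\<close> because both linear slots of a section
  cocycle coincide.\<close>

theorem theorem6p4:
  fixes L :: "('k::field_char_0, 'l::ab_group_add) invder_struct"
    and V :: "('k, 'v::ab_group_add) invder_struct"
  assumes "invder_lie_algebra L"
    and "invder_lie_algebra V"
    and "abelian V"
  shows
    "(\<forall>E :: ('k, 'v, 'l, 'e1::ab_group_add) extension. central_extension L V E \<longrightarrow>
        ext_class L V E \<in> H2 L V \<and>
        (\<exists>s. linear_section L E s) \<and>
        (\<forall>s. linear_section L E s \<longrightarrow>
           section_cocycle L E s \<in> cocycles2 L V \<and> section_cocycle L E s \<in> ext_class L V E))
     \<and> (\<forall>(E1 :: ('k, 'v, 'l, 'e1) extension) (E2 :: ('k, 'v, 'l, 'e2::ab_group_add) extension).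
        central_extension L V E1 \<and> central_extension L V E2 \<longrightarrow>
        (ext_iso E1 E2 \<longleftrightarrow> ext_class L V E1 = ext_class L V E2))
     \<and> (\<forall>E1 :: ('k, 'v, 'l, 'e1) extension. central_extension L V E1 \<longrightarrow>
        (\<exists>E2 :: ('k, 'v, 'l, 'v \<times> 'l) extension. central_extension L V E2 \<and> ext_iso E1 E2))
     \<and> equiv {E :: ('k, 'v, 'l, 'v \<times> 'l) extension. central_extension L V E} (ext_iso_rel L V)
     \<and> bij_betw (\<lambda>C. the_elem (ext_class L V ` C))
        ({E :: ('k, 'v, 'l, 'v \<times> 'l) extension. central_extension L V E} // ext_iso_rel L V)
        (H2_diag L V)"
proof -
  interpret invder_pair L V
    using assms by (simp add: invder_pair_def invder_pair_axioms_def)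
  have "ext_class L V E \<in> H2 L V \<and> (\<exists>s. linear_section L E s) \<and>
      (\<forall>s. linear_section L E s \<longrightarrow>
        section_cocycle L E s \<in> cocycles2 L V \<and> section_cocycle L E s \<in> ext_class L V E)"
    if "central_extension L V E" for E :: "('k, 'v, 'l, 'e1) extension"
  proof -
    interpret E: invder_central_extension L V E
      using that by unfold_locales
    show ?thesis
      using E.ext_class_in_H2_diag E.ex_linear_section E.section_cocycle_in_cocycles2
        E.section_cocycles_cohomologous
      by (auto simp: H2_diag_def E.ext_class_eq)
  qed
  moreover have "\<exists>E2 :: ('k, 'v, 'l, 'v \<times> 'l) extension. central_extension L V E2 \<and> ext_iso E1 E2"
    if E1: "central_extension L V E1" for E1 :: "('k, 'v, 'l, 'e1) extension"
  proof -
    interpret E1: invder_central_extension L V E1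
      using that by unfold_locales
    obtain E2 :: "('k, 'v, 'l, 'v \<times> 'l) extension"
      where "central_extension L V E2" "ext_class L V E2 = ext_class L V E1"
      using E1.ext_class_in_H2_diag by (rule H2_diag_ext_class)
    then show ?thesis
      using ext_iso_iff_ext_class_eq[OF E1] by metis
  qed
  ultimately show ?thesis
    using ext_iso_iff_ext_class_eq equiv_ext_iso_rel bij_betw_ext_class by blast
qed

end
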